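(* Let $A=(s_{ij})$ be a symmetric $3\times 3$ real matrix with $s_{11}=s_{22}=s_{33}=0$ and $s_{ij}>0$ for all $i\neq j$. Put $d_1=s_{21}-s_{32}+s_{31}$, $d_2=s_{21}+s_{32}-s_{31}$, $d_3=-s_{21}+s_{32}+s_{31}$, and suppose $d_j\neq 0$ for $j=1,2,3$. Let $\mathcal{C}=\mathcal{C}(A)$ be the tropical conic of $A$ and let $v^0,v^1,v^2,v^3$ be the points associated to $A$. Then exactly one of the following two mutually exclusive cases occurs. 1. (One-point central conic.) $d_1,d_2,d_3$ are all positive. In this case $\mathcal{C}$ has exactly four non-pendant vertices; these are $v^1,v^2,v^3$ and $v^0$. 2. (Two-point central conic.) $d_j<0$ for some $j\in\{1,2,3\}$. In this case $\mathcal{C}$ has exactly four non-pendant vertices; these are $v^{j-1}$, $v^{j+1}$, $w^{j-1}=v^{j-1}+t^{j-1,j}$ and $w^{j+1}=v^{j+1}+t^{j+1,j}$, where the indices $j-1,j+1$ are taken modulo $3$ in $\{1,2,3\}$ and $t^{i,j}$ denotes the point whose $i$-th coordinate is $-2s_{ij}$ and whose other two coordinates are $0$.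
   Context: $\mathbb{T}=\mathbb{R}\cup\{-\infty\}$. The tropical projective plane $\mathbb{T}\mathbb{P}^2$ is the set of classes $[b_1,b_2,b_3]$ of triples in $\mathbb{T}^3\setminus\{(-\infty,-\infty,-\infty)\}$ under $(b_1,b_2,b_3)\sim(b_1+\lambda,b_2+\lambda,b_3+\lambda)$, $\lambda\in\mathbb{R}$. Points are added coordinatewise. For the symmetric matrix $A=(s_{ij})$ with zero diagonal, the tropical conic $\mathcal{C}(A)$ is the set of points $[X,Y,Z]\in\mathbb{T}\mathbb{P}^2$ at which the maximum $$\max\{2X,\ 2Y,\ 2Z,\ s_{21}+X+Y,\ s_{32}+Y+Z,\ s_{31}+X+Z\}$$ is attained by at least two of the six terms. The non-pendant vertices of $\mathcal{C}(A)$ are the points of $\mathcal{C}(A)$ at which the maximum is attained by at least three of the six terms. The points associated to $A$ are $v^1=[-s_{11},-s_{21},-s_{31}]$, $v^2=[-s_{21},-s_{22},-s_{32}]$, $v^3=[-s_{31},-s_{32},-s_{33}]$ and $v^0=[s_{32},s_{31},s_{21}]$. *)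

theory Defs
  imports "HOL-Analysis.Analysis"
begin

text \<open>
  Coordinates are indexed by the numeral type \<open>3\<close>, whose arithmetic is modulo 3 and in which
  \<open>3 = 0\<close>; so \<open>j - 1\<close> and \<open>j + 1\<close> are the cyclic neighbours of an index \<open>j\<close> in \<open>{1, 2, 3}\<close>.
  The tropical semifield is represented by the extended reals other than \<open>\<infinity>\<close>.
\<close>

definition tp2_carrier :: "(ereal ^ 3) set" where
  "tp2_carrier = {x. (\<forall>i. x $ i \<noteq> \<infinity>) \<and> (\<exists>i. x $ i \<noteq> -\<infinity>)}"

definition tp2_rel :: "ereal ^ 3 \<Rightarrow> ereal ^ 3 \<Rightarrow> bool" where
  "tp2_rel x y \<longleftrightarrow> x \<in> tp2_carrier \<and> y \<in> tp2_carrier \<and> (\<exists>c::real. \<forall>i. y $ i = x $ i + ereal c)"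

quotient_type tp2 = "ereal ^ 3" / partial: tp2_rel
proof (rule part_equivpI)
  show "\<exists>x. tp2_rel x x"
    by (rule exI[of _ 0]) (auto simp: tp2_rel_def tp2_carrier_def intro!: exI[of _ "0::real"])
  show "symp tp2_rel"
  proof (rule sympI)
    fix x y assume "tp2_rel x y"
    then obtain c where c: "\<forall>i. y $ i = x $ i + ereal c" "x \<in> tp2_carrier" "y \<in> tp2_carrier"
      by (auto simp: tp2_rel_def)
    have "x $ i = y $ i + ereal (- c)" for i
      using c(1) by (cases "x $ i") auto
    with c show "tp2_rel y x" unfolding tp2_rel_def by blast
  qed
  show "transp tp2_rel"
  proof (rule transpI)
    fix x y z assume "tp2_rel x y" "tp2_rel y z"
    then obtain c d where c: "\<forall>i. y $ i = x $ i + ereal c" "\<forall>i. z $ i = y $ i + ereal d"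
      "x \<in> tp2_carrier" "z \<in> tp2_carrier"
      unfolding tp2_rel_def by metis
    have "z $ i = x $ i + ereal (c + d)" for i
      using c(1,2) by (cases "x $ i") auto
    with c show "tp2_rel x z" unfolding tp2_rel_def by blast
  qed
qed

text \<open>The class of a triple of real numbers.\<close>

lift_definition tp2_point :: "real ^ 3 \<Rightarrow> tp2" is "\<lambda>x. \<chi> i. ereal (x $ i)"
  by (auto simp: tp2_rel_def tp2_carrier_def intro!: exI[of _ "0::real"])

text \<open>
  Coordinatewise addition is undefined when every coordinate of the sum is \<open>-\<infinity>\<close>; in that case
  the result is set to \<open>[0, 0, 0]\<close>. This never happens if one of the points has only real
  coordinates.
\<close>

instantiation tp2 :: plus
begin

lift_definition plus_tp2 :: "tp2 \<Rightarrow> tp2 \<Rightarrow> tp2" is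
  "\<lambda>x y. if \<forall>i. x $ i + y $ i = -\<infinity> then 0 else x + y"
proof -
  fix x x' y y' assume "tp2_rel x x'" "tp2_rel y y'"
  then obtain c d where c: "\<forall>i. x' $ i = x $ i + ereal c" "\<forall>i. y' $ i = y $ i + ereal d"
    and carr: "x \<in> tp2_carrier" "x' \<in> tp2_carrier" "y \<in> tp2_carrier" "y' \<in> tp2_carrier"
    by (auto simp: tp2_rel_def)
  have eq: "x' $ i + y' $ i = x $ i + y $ i + ereal (c + d)" for i
    using c by (cases "x $ i"; cases "y $ i") auto
  have inf: "x' $ i + y' $ i = -\<infinity> \<longleftrightarrow> x $ i + y $ i = -\<infinity>" for i
    unfolding eq by (cases "x $ i + y $ i") auto
  have npi: "x $ i + y $ i \<noteq> \<infinity>" "x' $ i + y' $ i \<noteq> \<infinity>" for i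
    using carr by (auto simp: tp2_carrier_def)
  show "tp2_rel (if \<forall>i. x $ i + y $ i = -\<infinity> then 0 else x + y)
                (if \<forall>i. x' $ i + y' $ i = -\<infinity> then 0 else x' + y')"
  proof (cases "\<forall>i. x $ i + y $ i = -\<infinity>")
    case True
    then show ?thesis
      using inf by (auto simp: tp2_rel_def tp2_carrier_def intro!: exI[of _ "0::real"])
  next
    case False
    have "tp2_rel (x + y) (x' + y')"
      unfolding tp2_rel_def tp2_carrier_def
      using False npi eq inf by (auto intro!: exI[of _ "c + d"])
    moreover have "\<not> (\<forall>i. x' $ i + y' $ i = -\<infinity>)"
      using False inf by blast
    ultimately show ?thesis
      using False by (simp only: if_False)
  qed
qed

instance ..

end

lemma tp2_point_eq_iff:
  "tp2_point x = tp2_point y \<longleftrightarrow> (\<exists>c. \<forall>i. y $ i = x $ i + c)"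
  by transfer (auto simp: tp2_rel_def tp2_carrier_def)

lemma tp2_point_add: "tp2_point x + tp2_point y = tp2_point (x + y)"
  by transfer (auto simp: tp2_rel_def tp2_carrier_def intro!: exI[of _ "0::real"])

definition conic_terms :: "real ^ 3 ^ 3 \<Rightarrow> ereal ^ 3 \<Rightarrow> ereal list" where
  "conic_terms A x =
    [2 * x $ 1, 2 * x $ 2, 2 * x $ 3,
     ereal (A $ 2 $ 1) + x $ 1 + x $ 2,
     ereal (A $ 3 $ 2) + x $ 2 + x $ 3,
     ereal (A $ 3 $ 1) + x $ 1 + x $ 3]"

text \<open>The number of the six terms, counted with repetition, that attain the maximum.\<close>

lift_definition conic_max_count :: "real ^ 3 ^ 3 \<Rightarrow> tp2 \<Rightarrow> nat" is
  "\<lambda>A x. count_list (conic_terms A x) (Max (set (conic_terms A x)))"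
proof -
  fix A x y assume "tp2_rel x y"
  then obtain c where c: "\<forall>i. y $ i = x $ i + ereal c"
    by (auto simp: tp2_rel_def)
  define f where "f = (\<lambda>u. u + ereal (2 * c))"
  have inj: "inj f"
  proof (rule injI)
    fix u v assume "f u = f v"
    then show "u = v" by (cases u; cases v) (auto simp: f_def)
  qed
  have mono: "mono f"
    by (auto simp: f_def mono_def intro: add_right_mono)
  have "2 * (u + ereal c) = f (2 * u)" for u
    by (cases u) (auto simp: f_def)
  moreover have "ereal s + (u + ereal c) + (v + ereal c) = f (ereal s + u + v)" for s u v
    by (cases u; cases v) (auto simp: f_def)
  ultimately have terms: "conic_terms A y = map f (conic_terms A x)"
    unfolding conic_terms_def using c by simp
  have "Max (f ` set (conic_terms A x)) = f (Max (set (conic_terms A x)))"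
    by (rule mono_Max_commute[OF mono, symmetric]) (auto simp: conic_terms_def)
  then show "count_list (conic_terms A x) (Max (set (conic_terms A x))) =
      count_list (conic_terms A y) (Max (set (conic_terms A y)))"
    unfolding terms
    by (metis Max_in count_list_map_conv inj inj_on_subset list.set_map subset_UNIV
        List.finite_set conic_terms_def list.distinct(1) set_empty count_list_inj_map)
qed

definition tropical_conic :: "real ^ 3 ^ 3 \<Rightarrow> tp2 set" where
  "tropical_conic A = {P. conic_max_count A P \<ge> 2}"

definition non_pendant_vertices :: "real ^ 3 ^ 3 \<Rightarrow> tp2 set" where
  "non_pendant_vertices A = {P \<in> tropical_conic A. conic_max_count A P \<ge> 3}"

text \<open>The points associated to a symmetric matrix \<open>A\<close>; \<open>vpt A j\<close> is column \<open>j\<close> of \<open>-A\<close>.\<close>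

definition vpt :: "real ^ 3 ^ 3 \<Rightarrow> 3 \<Rightarrow> tp2" where
  "vpt A j = tp2_point (- column j A)"

definition vpt0 :: "real ^ 3 ^ 3 \<Rightarrow> tp2" where
  "vpt0 A = tp2_point (vector [A $ 3 $ 2, A $ 3 $ 1, A $ 2 $ 1])"

definition tpt :: "real ^ 3 ^ 3 \<Rightarrow> 3 \<Rightarrow> 3 \<Rightarrow> tp2" where
  "tpt A i j = tp2_point (\<chi> k. if k = i then - 2 * A $ i $ j else 0)"

end

theory Submission
  imports Defs
begin

text \<open>
  A conic point with three maximal terms has only real coordinates, so it can be normalised to
  \<open>[0, y, z]\<close>. Since the off-diagonal entries are positive, two of the squares \<open>2X, 2Y, 2Z\<close> are
  never maximal together; hence at least two of the three mixed terms are maximal, and each choice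
  of three maximal terms determines \<open>(y, z)\<close>. The remaining inequalities become sign conditions on
  the \<open>d\<^sub>j\<close>. As \<open>d\<^sub>i + d\<^sub>j\<close> is twice an off-diagonal entry for \<open>i \<noteq> j\<close>, at most one \<open>d\<^sub>j\<close> is
  negative.
\<close>

section \<open>Maximal terms in the chart X = 0\<close>

text \<open>An upper bound that is counted at least once lies in the list, so it is the maximum.
  Trading \<open>Max\<close> for a bound \<open>m\<close> turns the counting condition into linear
  inequalities and equations.\<close>

lemma count_list_Max_ge_iff:
  fixes xs :: "'a::linorder list"
  assumes "k > 0" "xs \<noteq> []"
  shows "k \<le> count_list xs (Max (set xs)) \<longleftrightarrow>
    (\<exists>m. (\<forall>x\<in>set xs. x \<le> m) \<and> k \<le> count_list xs m)"
proof
  assume "k \<le> count_list xs (Max (set xs))"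
  then show "\<exists>m. (\<forall>x\<in>set xs. x \<le> m) \<and> k \<le> count_list xs m"
    by (meson List.finite_set Max_ge)
next
  assume "\<exists>m. (\<forall>x\<in>set xs. x \<le> m) \<and> k \<le> count_list xs m"
  then obtain m where m: "\<forall>x\<in>set xs. x \<le> m" "k \<le> count_list xs m"
    by blast
  have "m \<in> set xs"
    using m(2) \<open>k > 0\<close> by (metis count_list_0_iff not_le)
  then have "Max (set xs) = m"
    using m(1) by (intro Max_eqI) auto
  then show "k \<le> count_list xs (Max (set xs))"
    using m(2) by simp
qed

text \<open>These are the conic's six terms at X = 0, as reals so that linear arithmetic applies,
  and in the order of \<open>conic_terms\<close>.\<close>

definition affine_terms :: "real \<Rightarrow> real \<Rightarrow> real \<Rightarrow> real \<Rightarrow> real \<Rightarrow> real list" where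
  "affine_terms a b c y z = [0, 2 * y, 2 * z, a + y, b + y + z, c + z]"

text \<open>The embedding \<open>ereal\<close> is monotone, so it commutes with \<open>Max\<close>,
  and injective, so it preserves multiplicities.\<close>

lemma conic_max_count_affine:
  "conic_max_count A (tp2_point (vector [0, y, z])) =
    (let ts = affine_terms (A $ 2 $ 1) (A $ 3 $ 2) (A $ 3 $ 1) y z in count_list ts (Max (set ts)))"
proof -
  define ts where "ts = affine_terms (A $ 2 $ 1) (A $ 3 $ 2) (A $ 3 $ 1) y z"
  have terms: "conic_terms A (\<chi> i. ereal (vector [0, y, z] $ i)) = map ereal ts"
    by (simp add: conic_terms_def ts_def affine_terms_def vector_3 flip: zero_ereal_def)
  have "Max (ereal ` set ts) = ereal (Max (set ts))"
    by (rule mono_Max_commute[symmetric]) (auto simp: mono_def ts_def affine_terms_def)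
  then have "count_list (map ereal ts) (Max (set (map ereal ts))) = count_list ts (Max (set ts))"
    by (simp add: count_list_map_conv inj_def)
  moreover have "tp2_rel (\<chi> i. ereal (vector [0, y, z] $ i)) (\<chi> i. ereal (vector [0, y, z] $ i))"
    by (auto simp: tp2_rel_def tp2_carrier_def intro!: exI[of _ "0::real"])
  ultimately show ?thesis
    unfolding Let_def ts_def[symmetric]
    by (simp add: conic_max_count.abs_eq tp2_point.abs_eq terms)
qed

text \<open>
  With \<open>(a, b, c) = (s\<^sub>2\<^sub>1, s\<^sub>3\<^sub>2, s\<^sub>3\<^sub>1)\<close>, the disjuncts are \<open>v\<^sup>1\<close>, \<open>v\<^sup>2\<close>, \<open>v\<^sup>3\<close>, \<open>v\<^sup>0\<close>, followed by the two
  points \<open>w\<close> for \<open>d\<^sub>1 \<le> 0\<close>, \<open>d\<^sub>2 \<le> 0\<close> and \<open>d\<^sub>3 \<le> 0\<close>.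
\<close>

lemma affine_vertex_iff:
  fixes a b c y z :: real
  assumes "a > 0" "b > 0" "c > 0"
  shows "3 \<le> count_list (affine_terms a b c y z) (Max (set (affine_terms a b c y z))) \<longleftrightarrow>
    b \<le> a + c \<and> y = - a \<and> z = - c \<or>
    c \<le> a + b \<and> y = a \<and> z = a - b \<or>
    a \<le> b + c \<and> y = c - b \<and> z = c \<or>
    b \<le> a + c \<and> c \<le> a + b \<and> a \<le> b + c \<and> y = c - b \<and> z = a - b \<or>
    a + c \<le> b \<and> (y = - a \<and> z = a - b \<or> y = c - b \<and> z = - c) \<or>
    a + b \<le> c \<and> (y = a \<and> z = 2 * a - c \<or> y = c - b \<and> z = c - 2 * b) \<or>
    b + c \<le> a \<and> (y = 2 * c - a \<and> z = c \<or> y = a - 2 * b \<and> z = a - b)"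
    (is "_ \<longleftrightarrow> ?R")
proof -
  have "3 \<le> count_list (affine_terms a b c y z) (Max (set (affine_terms a b c y z))) \<longleftrightarrow>
      (\<exists>m. 0 \<le> m \<and> 2 * y \<le> m \<and> 2 * z \<le> m \<and> a + y \<le> m \<and> b + y + z \<le> m \<and> c + z \<le> m \<and>
        3 \<le> count_list (affine_terms a b c y z) m)"
    by (subst count_list_Max_ge_iff) (simp_all add: affine_terms_def)
  also have "\<dots> \<longleftrightarrow> ?R"
  proof
    assume "\<exists>m. 0 \<le> m \<and> 2 * y \<le> m \<and> 2 * z \<le> m \<and> a + y \<le> m \<and> b + y + z \<le> m \<and> c + z \<le> m \<and>
        3 \<le> count_list (affine_terms a b c y z) m"
    then obtain m where m: "0 \<le> m" "2 * y \<le> m" "2 * z \<le> m" "a + y \<le> m" "b + y + z \<le> m" "c + z \<le> m"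
      and count: "3 \<le> count_list (affine_terms a b c y z) m"
      by blast
    \<comment> \<open>Two squares both equal to \<open>m\<close> would make the mixed term of the
      same two coordinates equal to \<open>m\<close> plus a positive entry, exceeding the
      bound.\<close>
    have "\<not> (0 = m \<and> 2 * y = m)" "\<not> (0 = m \<and> 2 * z = m)" "\<not> (2 * y = m \<and> 2 * z = m)"
      using m assms by linarith+
    then consider "0 = m" "2 * y \<noteq> m" "2 * z \<noteq> m" | "0 \<noteq> m" "2 * y = m" "2 * z \<noteq> m"
      | "0 \<noteq> m" "2 * y \<noteq> m" "2 * z = m" | "0 \<noteq> m" "2 * y \<noteq> m" "2 * z \<noteq> m"
      by argo
    then show ?R
    proof cases
      case 1
      then consider "a + y = m" "b + y + z = m" | "a + y = m" "c + z = m" | "b + y + z = m" "c + z = m"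
        using count by (auto simp: affine_terms_def split: if_splits)
      then show ?thesis
        by cases (use m 1 in argo)+
    next
      case 2
      then consider "a + y = m" "b + y + z = m" | "a + y = m" "c + z = m" | "b + y + z = m" "c + z = m"
        using count by (auto simp: affine_terms_def split: if_splits)
      then show ?thesis
        by cases (use m 2 in argo)+
    next
      case 3
      then consider "a + y = m" "b + y + z = m" | "a + y = m" "c + z = m" | "b + y + z = m" "c + z = m"
        using count by (auto simp: affine_terms_def split: if_splits)
      then show ?thesis
        by cases (use m 3 in argo)+
    next
      case 4
      \<comment> \<open>With no maximal square all three mixed terms are maximal. Equating them
        gives \<open>y = c - b\<close> and \<open>z = a - b\<close>, the point
        \<open>v\<^sup>0\<close>.\<close>
      then have "a + y = m" "b + y + z = m" "c + z = m"
        using count by (auto simp: affine_terms_def split: if_splits)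
      then show ?thesis
        using m by argo
    qed
  next
    assume ?R
    then show "\<exists>m. 0 \<le> m \<and> 2 * y \<le> m \<and> 2 * z \<le> m \<and> a + y \<le> m \<and> b + y + z \<le> m \<and> c + z \<le> m \<and>
        3 \<le> count_list (affine_terms a b c y z) m"
    \<comment> \<open>The witness is the maximal value: the square attaining it, or at
      \<open>v\<^sup>0\<close>, where possibly no square does, a mixed term.\<close>
    proof (elim disjE conjE, goal_cases)
      case 1 then show ?case using assms by (intro exI[of _ 0]) (simp add: affine_terms_def)
    next
      case 2 then show ?case using assms by (intro exI[of _ "2 * y"]) (simp add: affine_terms_def)
    next
      case 3 then show ?case using assms by (intro exI[of _ "2 * z"]) (simp add: affine_terms_def)
    next
      case 4 then show ?case using assms by (intro exI[of _ "a + y"]) (simp add: affine_terms_def)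
    next
      case 5 then show ?case using assms by (intro exI[of _ 0]) (simp add: affine_terms_def)
    next
      case 6 then show ?case using assms by (intro exI[of _ 0]) (simp add: affine_terms_def)
    next
      case 7 then show ?case using assms by (intro exI[of _ "2 * y"]) (simp add: affine_terms_def)
    next
      case 8 then show ?case using assms by (intro exI[of _ "2 * y"]) (simp add: affine_terms_def)
    next
      case 9 then show ?case using assms by (intro exI[of _ "2 * z"]) (simp add: affine_terms_def)
    next
      case 10 then show ?case using assms by (intro exI[of _ "2 * z"]) (simp add: affine_terms_def)
    qed
  qed
  finally show ?thesis .
qed

section \<open>Reduction from the projective plane to the chart\<close>

lemma tp2_point_affine_eq_iff:
  "tp2_point (vector [0, y, z]) = tp2_point (vector [0, y', z']) \<longleftrightarrow> y = y' \<and> z = z'"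
  by (auto simp: tp2_point_eq_iff forall_3)

lemma tp2_point_affine:
  assumes "r $ 2 - r $ 1 = y" "r $ 3 - r $ 1 = z"
  shows "tp2_point r = tp2_point (vector [0, y, z])"
  unfolding tp2_point_eq_iff using assms by (intro exI[of _ "- r $ 1"]) (simp add: forall_3)

lemma exists_3: "(\<exists>i::3. P i) \<longleftrightarrow> P 1 \<or> P 2 \<or> P 3"
  by (metis exhaust_3)

lemma ereal_squares_max_unique:
  fixes u v m :: ereal
  assumes "s > 0" "2 * u = m" "2 * v = m" "ereal s + u + v \<le> m" "m \<noteq> -\<infinity>" "u \<noteq> \<infinity>" "v \<noteq> \<infinity>"
  shows False
  using assms by (cases u; cases v) (auto simp: numeral_eq_ereal)

text \<open>A coordinate equal to minus infinity sends its square and both its mixed terms to minus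
  infinity, below the maximum. The three remaining terms would then all be maximal, among them two
  squares.\<close>

lemma three_max_terms_finite:
  assumes "\<forall>i j. i \<noteq> j \<longrightarrow> A $ i $ j > 0" "x \<in> tp2_carrier"
    and "3 \<le> count_list (conic_terms A x) (Max (set (conic_terms A x)))"
  shows "\<bar>x $ i\<bar> \<noteq> \<infinity>"
proof -
  obtain m where m: "\<forall>t\<in>set (conic_terms A x). t \<le> m" "3 \<le> count_list (conic_terms A x) m"
    using assms(3) by (subst (asm) count_list_Max_ge_iff) (auto simp: conic_terms_def)
  have pos: "A $ 2 $ 1 > 0" "A $ 3 $ 2 > 0" "A $ 3 $ 1 > 0"
    using assms(1) by auto
  have fin: "x $ 1 \<noteq> \<infinity>" "x $ 2 \<noteq> \<infinity>" "x $ 3 \<noteq> \<infinity>"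
    using assms(2) by (simp_all add: tp2_carrier_def)
  have le: "2 * x $ 1 \<le> m" "2 * x $ 2 \<le> m" "2 * x $ 3 \<le> m"
    "ereal (A $ 2 $ 1) + x $ 1 + x $ 2 \<le> m" "ereal (A $ 3 $ 2) + x $ 2 + x $ 3 \<le> m"
    "ereal (A $ 3 $ 1) + x $ 1 + x $ 3 \<le> m"
    using m(1) by (simp_all add: conic_terms_def)
  have double: "2 * u = -\<infinity> \<longleftrightarrow> u = -\<infinity>" for u :: ereal
    by (cases u) (auto simp: numeral_eq_ereal)
  have cross: "ereal s + u + v = -\<infinity>" if "u = -\<infinity> \<or> v = -\<infinity>" "u \<noteq> \<infinity>" "v \<noteq> \<infinity>"
    for s and u v :: ereal
    using that by (cases u; cases v) auto
  have "x $ 1 \<noteq> -\<infinity> \<or> x $ 2 \<noteq> -\<infinity> \<or> x $ 3 \<noteq> -\<infinity>"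
    using assms(2) by (simp add: tp2_carrier_def exists_3)
  then have "m \<noteq> -\<infinity>"
    using le(1-3) double by auto
  have "x $ 1 \<noteq> -\<infinity>"
  proof
    assume "x $ 1 = -\<infinity>"
    then have "2 * x $ 1 \<noteq> m" "ereal (A $ 2 $ 1) + x $ 1 + x $ 2 \<noteq> m"
      "ereal (A $ 3 $ 1) + x $ 1 + x $ 3 \<noteq> m"
      using \<open>m \<noteq> -\<infinity>\<close> fin double cross by metis+
    then have "2 * x $ 2 = m" "2 * x $ 3 = m"
      using m(2) by (simp_all add: conic_terms_def split: if_splits)
    then show False
      using ereal_squares_max_unique pos(2) le(5) \<open>m \<noteq> -\<infinity>\<close> fin by blast
  qed
  moreover have "x $ 2 \<noteq> -\<infinity>"
  proof
    assume "x $ 2 = -\<infinity>"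
    then have "2 * x $ 2 \<noteq> m" "ereal (A $ 2 $ 1) + x $ 1 + x $ 2 \<noteq> m"
      "ereal (A $ 3 $ 2) + x $ 2 + x $ 3 \<noteq> m"
      using \<open>m \<noteq> -\<infinity>\<close> fin double cross by metis+
    then have "2 * x $ 1 = m" "2 * x $ 3 = m"
      using m(2) by (simp_all add: conic_terms_def split: if_splits)
    then show False
      using ereal_squares_max_unique pos(3) le(6) \<open>m \<noteq> -\<infinity>\<close> fin by blast
  qed
  moreover have "x $ 3 \<noteq> -\<infinity>"
  proof
    assume "x $ 3 = -\<infinity>"
    then have "2 * x $ 3 \<noteq> m" "ereal (A $ 3 $ 2) + x $ 2 + x $ 3 \<noteq> m"
      "ereal (A $ 3 $ 1) + x $ 1 + x $ 3 \<noteq> m"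
      using \<open>m \<noteq> -\<infinity>\<close> fin double cross by metis+
    then have "2 * x $ 1 = m" "2 * x $ 2 = m"
      using m(2) by (simp_all add: conic_terms_def split: if_splits)
    then show False
      using ereal_squares_max_unique pos(1) le(4) \<open>m \<noteq> -\<infinity>\<close> fin by blast
  qed
  ultimately show ?thesis
    using fin exhaust_3[of i] by auto
qed

lemma non_pendant_vertex_affine:
  assumes "\<forall>i j. i \<noteq> j \<longrightarrow> A $ i $ j > 0" "3 \<le> conic_max_count A P"
  shows "\<exists>y z. P = tp2_point (vector [0, y, z])"
proof -
  obtain x where x: "tp2_rel x x" "P = abs_tp2 x"
    using Quotient3_tp2 by (metis Quotient3_abs_rep Quotient3_rep_reflp)
  have "\<bar>x $ i\<bar> \<noteq> \<infinity>" for i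
    using assms x by (intro three_max_terms_finite[of A])
      (auto simp: conic_max_count.abs_eq tp2_rel_def)
  \<comment> \<open>The representative is the image of a real vector, the form in which
    \<open>tp2_point.abs_eq\<close> applies.\<close>
  then have "x = (\<chi> i. ereal ((\<chi> i. real_of_ereal (x $ i)) $ i))"
    by (simp add: vec_eq_iff ereal_real')
  then have "P = tp2_point (\<chi> i. real_of_ereal (x $ i))"
    using x by (simp add: tp2_point.abs_eq)
  then show ?thesis
    using tp2_point_affine by blast
qed

lemma non_pendant_vertices_affine:
  assumes "\<forall>i j. i \<noteq> j \<longrightarrow> A $ i $ j > 0"
  shows "non_pendant_vertices A = (\<lambda>(y, z). tp2_point (vector [0, y, z])) `
    {(y, z). let ts = affine_terms (A $ 2 $ 1) (A $ 3 $ 2) (A $ 3 $ 1) y z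
      in 3 \<le> count_list ts (Max (set ts))}"
proof -
  have "non_pendant_vertices A = {P. 3 \<le> conic_max_count A P}"
    by (auto simp: non_pendant_vertices_def tropical_conic_def)
  also have "\<dots> = (\<lambda>(y, z). tp2_point (vector [0, y, z])) `
      {(y, z). 3 \<le> conic_max_count A (tp2_point (vector [0, y, z]))}"
  proof (intro equalityI subsetI)
    fix P assume "P \<in> {P. 3 \<le> conic_max_count A P}"
    then have P: "3 \<le> conic_max_count A P"
      by simp
    then obtain y z where "P = tp2_point (vector [0, y, z])"
      using non_pendant_vertex_affine[OF assms] by blast
    with P show "P \<in> (\<lambda>(y, z). tp2_point (vector [0, y, z])) `
        {(y, z). 3 \<le> conic_max_count A (tp2_point (vector [0, y, z]))}"
      by (intro image_eqI[of _ _ "(y, z)"]) simp_all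
  qed auto
  finally show ?thesis
    by (simp add: conic_max_count_affine Let_def)
qed

section \<open>Sign cases for the \<open>d\<^sub>j\<close>\<close>

theorem theorem1:
  fixes A :: "real ^ 3 ^ 3" and d :: "real ^ 3"
  assumes "transpose A = A"
    and "\<forall>i. A $ i $ i = 0"
    and "\<forall>i j. i \<noteq> j \<longrightarrow> A $ i $ j > 0"
    and "d = vector [A $ 2 $ 1 - A $ 3 $ 2 + A $ 3 $ 1,
                     A $ 2 $ 1 + A $ 3 $ 2 - A $ 3 $ 1,
                     - A $ 2 $ 1 + A $ 3 $ 2 + A $ 3 $ 1]"
    and "\<forall>j. d $ j \<noteq> 0"
  shows "((\<forall>j. d $ j > 0) \<or> (\<exists>j. d $ j < 0)) \<and>
    \<not> ((\<forall>j. d $ j > 0) \<and> (\<exists>j. d $ j < 0)) \<and>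
    ((\<forall>j. d $ j > 0) \<longrightarrow>
      card (non_pendant_vertices A) = 4 \<and>
      non_pendant_vertices A = {vpt A 1, vpt A 2, vpt A 3, vpt0 A}) \<and>
    (\<forall>j. d $ j < 0 \<longrightarrow>
      card (non_pendant_vertices A) = 4 \<and>
      non_pendant_vertices A =
        {vpt A (j - 1), vpt A (j + 1),
         vpt A (j - 1) + tpt A (j - 1) j,
         vpt A (j + 1) + tpt A (j + 1) j})"
proof -
  define a b c where "a = A $ 2 $ 1" and "b = A $ 3 $ 2" and "c = A $ 3 $ 1"
  define p where "p = (\<lambda>(y, z). tp2_point (vector [0, y, z]))"
  have "inj p"
    by (auto simp: p_def inj_def tp2_point_affine_eq_iff)
  have sym: "A $ i $ j = A $ j $ i" for i j
  proof -
    have "A $ i $ j = transpose A $ i $ j"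
      using assms(1) by simp
    then show ?thesis
      by (simp add: transpose_def)
  qed
  have A: "A $ 1 $ 1 = 0" "A $ 2 $ 2 = 0" "A $ 3 $ 3 = 0" "A $ 2 $ 1 = a" "A $ 1 $ 2 = a"
    "A $ 3 $ 2 = b" "A $ 2 $ 3 = b" "A $ 3 $ 1 = c" "A $ 1 $ 3 = c"
    using assms(2) by (simp_all add: a_def b_def c_def sym[of 1 2] sym[of 2 3] sym[of 1 3])
  have pos: "a > 0" "b > 0" "c > 0"
    using assms(3) by (auto simp: a_def b_def c_def)
  have d: "d $ 1 = a - b + c" "d $ 2 = a + b - c" "d $ 3 = - a + b + c"
    unfolding assms(4) A by (simp_all add: vector_3)
  have nz: "a - b + c \<noteq> 0" "a + b - c \<noteq> 0" "- a + b + c \<noteq> 0"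
    using assms(5) d by metis+
  define S where
    "S = {(y, z). let ts = affine_terms a b c y z in 3 \<le> count_list ts (Max (set ts))}"
  have S: "non_pendant_vertices A = p ` S"
    using non_pendant_vertices_affine[OF assms(3)] by (simp add: S_def p_def a_def b_def c_def)
  \<comment> \<open>Because \<open>p\<close> is injective, listing and counting the vertices can be
    done on pairs of reals.\<close>
  have four: "card (non_pendant_vertices A) = 4 \<and>
      non_pendant_vertices A = {p q1, p q2, p q3, p q4}"
    if "S = {q1, q2, q3, q4}" "distinct [q1, q2, q3, q4]" for q1 q2 q3 q4
  proof -
    have "card (p ` S) = card S"
      using \<open>inj p\<close> by (intro card_image) (rule inj_on_subset[OF _ subset_UNIV])
    with that show ?thesis
      by (simp add: S)
  qed
  have points: "vpt A 1 = p (- a, - c)" "vpt A 2 = p (a, a - b)" "vpt A 3 = p (c - b, c)"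
    "vpt0 A = p (c - b, a - b)"
    unfolding vpt_def vpt0_def p_def prod.case
    by (rule tp2_point_affine; simp add: column_def A)+
  \<comment> \<open>The shift changes coordinate \<open>i\<close> by \<open>- 2 * A $ i $ j\<close>.
    For \<open>i = 1\<close> renormalising the first coordinate to 0 moves both \<open>y\<close> and
    \<open>z\<close> up by twice the entry; otherwise only \<open>y\<close> or only \<open>z\<close>
    moves down.\<close>
  have shifted: "p (- a, - c) + tpt A 1 2 = p (a, 2 * a - c)"
    "p (- a, - c) + tpt A 1 3 = p (2 * c - a, c)"
    "p (a, a - b) + tpt A 2 1 = p (- a, a - b)"
    "p (a, a - b) + tpt A 2 3 = p (a - 2 * b, a - b)"
    "p (c - b, c) + tpt A 3 1 = p (c - b, - c)"
    "p (c - b, c) + tpt A 3 2 = p (c - b, c - 2 * b)"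
    unfolding tpt_def tp2_point_add p_def prod.case
    by (rule tp2_point_affine; simp add: A)+
  have index: "(1::3) - 1 = 3" "(1::3) + 1 = 2" "(2::3) - 1 = 1" "(2::3) + 1 = 3"
    "(3::3) - 1 = 2" "(3::3) + 1 = 1"
    by simp_all
  show ?thesis
    unfolding forall_3 exists_3 d index points shifted
  proof (intro conjI impI)
    show "a - b + c > 0 \<and> a + b - c > 0 \<and> - a + b + c > 0 \<or>
        a - b + c < 0 \<or> a + b - c < 0 \<or> - a + b + c < 0"
      using nz by argo
    show "\<not> ((a - b + c > 0 \<and> a + b - c > 0 \<and> - a + b + c > 0) \<and>
        (a - b + c < 0 \<or> a + b - c < 0 \<or> - a + b + c < 0))"
      by argo
    assume *: "a - b + c > 0 \<and> a + b - c > 0 \<and> - a + b + c > 0"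
    have "S = {(- a, - c), (a, a - b), (c - b, c), (c - b, a - b)}"
      using * unfolding S_def Let_def affine_vertex_iff[OF pos] by auto
    \<comment> \<open>Distinctness uses the strict signs: \<open>v\<^sup>0\<close> differs from
      \<open>v\<^sup>1\<close>, \<open>v\<^sup>2\<close>, \<open>v\<^sup>3\<close> by
      \<open>d\<^sub>1\<close>, \<open>d\<^sub>2\<close>, \<open>d\<^sub>3\<close> up to sign in
      some chart coordinate.\<close>
    from four[OF this] show "card (non_pendant_vertices A) = 4" "non_pendant_vertices A =
        {p (- a, - c), p (a, a - b), p (c - b, c), p (c - b, a - b)}"
      using * pos by auto
  next
    assume *: "a - b + c < 0"
    \<comment> \<open>Here \<open>b > a + c\<close> rules out \<open>v\<^sup>1\<close> and
      \<open>v\<^sup>0\<close>, while \<open>d\<^sub>2\<close> and \<open>d\<^sub>3\<close> are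
      positive, which keeps \<open>v\<^sup>2\<close> and \<open>v\<^sup>3\<close> and leaves only
      the \<open>w\<close> points for \<open>d\<^sub>1\<close>. The other two negative cases are
      analogous.\<close>
    have "S = {(c - b, c), (a, a - b), (c - b, - c), (- a, a - b)}"
      using * pos unfolding S_def Let_def affine_vertex_iff[OF pos] by auto
    from four[OF this] show "card (non_pendant_vertices A) = 4" "non_pendant_vertices A =
        {p (c - b, c), p (a, a - b), p (c - b, - c), p (- a, a - b)}"
      using * pos by auto
  next
    assume *: "a + b - c < 0"
    have "S = {(- a, - c), (c - b, c), (a, 2 * a - c), (c - b, c - 2 * b)}"
      using * pos unfolding S_def Let_def affine_vertex_iff[OF pos] by auto
    from four[OF this] show "card (non_pendant_vertices A) = 4" "non_pendant_vertices A =
        {p (- a, - c), p (c - b, c), p (a, 2 * a - c), p (c - b, c - 2 * b)}"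
      using * pos by auto
  next
    assume *: "- a + b + c < 0"
    have "S = {(a, a - b), (- a, - c), (a - 2 * b, a - b), (2 * c - a, c)}"
      using * pos unfolding S_def Let_def affine_vertex_iff[OF pos] by auto
    from four[OF this] show "card (non_pendant_vertices A) = 4" "non_pendant_vertices A =
        {p (a, a - b), p (- a, - c), p (a - 2 * b, a - b), p (2 * c - a, c)}"
      using * pos by auto
  qed
qed

end
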